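(* Let $\alpha,\beta\in\mathbb{R}$ and $\eta\in\{1,-1\}$. Let $G_4$ be the connected, simply connected three-dimensional Lie group with left-invariant Lorentzian metric $g$ whose Lie algebra has a pseudo-orthonormal basis $\{e_1,e_2,e_3\}$, $e_3$ timelike, with $$[e_1,e_2]=-e_2+(2\eta-\beta)e_3,\quad [e_1,e_3]=-\beta e_2+e_3,\quad [e_2,e_3]=\alpha e_1.$$ Let $V=\lambda_1e_1+\lambda_2e_2+\lambda_3e_3$ with $\lambda_1,\lambda_2,\lambda_3\in\mathbb{R}$, and let $\lambda\in\mathbb{R}$. Then $(G_4,V,g)$ is a left-invariant Riemann soliton with constant $\lambda$ if and only if one of the following holds (parameters not mentioned in a case are unrestricted): (i) $\beta\neq\eta$, $\alpha=0$, $\lambda_1=2-2\eta\beta$, $\lambda_2=\lambda_3=0$, $\lambda=0$; (ii) $\alpha-\beta+\eta=0$, $\lambda_2=-\eta\lambda_3$, $\lambda_1=1-\eta\beta$, $\lambda=\frac{\alpha^2}{4}$.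
   Context: Elements of the Lie algebra are identified with left-invariant vector fields. A pseudo-orthonormal basis $\{e_1,e_2,e_3\}$ with $e_3$ timelike means $g(e_1,e_1)=g(e_2,e_2)=1$, $g(e_3,e_3)=-1$, and $g(e_i,e_j)=0$ for $i\ne j$. Let $\nabla$ be the Levi-Civita connection of $g$, with curvature $R(X,Y)Z=\nabla_X\nabla_YZ-\nabla_Y\nabla_XZ-\nabla_{[X,Y]}Z$, and set $R(X,Y,Z,W)=-g(R(X,Y)Z,W)$. For $(0,2)$-tensors $T_1,T_2$ the Kulkarni-Nomizu product is $$(T_1\wedge T_2)(X,Y,Z,W)=T_1(X,W)T_2(Y,Z)+T_1(Y,Z)T_2(X,W)-T_1(X,Z)T_2(Y,W)-T_1(Y,W)T_2(X,Z).$$ $L_Vg$ denotes the Lie derivative of $g$ along $V$. For a left-invariant vector field $V$ and a real constant $\lambda$, $(G,V,g)$ is a left-invariant Riemann soliton with constant $\lambda$ if $R+\frac12 L_Vg\wedge g=\frac{\lambda}{2}g\wedge g$, i.e. for all vector fields $X,Y,Z,W$, $$2R(X,Y,Z,W)+g(X,W)(L_Vg)(Y,Z)+g(Y,Z)(L_Vg)(X,W)-g(X,Z)(L_Vg)(Y,W)-g(Y,W)(L_Vg)(X,Z)=2\lambda[g(X,W)g(Y,Z)-g(X,Z)g(Y,W)].$$ *)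

theory Defs
  imports "HOL-Analysis.Analysis" "HOL-Algebra.Group"
begin

section \<open>Smooth manifolds\<close>

text \<open>On an open subset of a Euclidean space, being of class \<open>C\<^sup>k\<^sup>+\<^sup>1\<close> means being differentiable
  with all directional derivatives of class \<open>C\<^sup>k\<close>.\<close>

primrec Ck_on :: "nat \<Rightarrow> 'a::euclidean_space set \<Rightarrow> ('a \<Rightarrow> 'b::euclidean_space) \<Rightarrow> bool" where
  "Ck_on 0 S f \<longleftrightarrow> continuous_on S f"
| "Ck_on (Suc k) S f \<longleftrightarrow>
     (\<forall>x\<in>S. f differentiable (at x)) \<and> (\<forall>v. Ck_on k S (\<lambda>x. frechet_derivative f (at x) v))"

definition smooth_on :: "'a::euclidean_space set \<Rightarrow> ('a \<Rightarrow> 'b::euclidean_space) \<Rightarrow> bool" where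
  "smooth_on S f \<longleftrightarrow> (\<forall>k. Ck_on k S f)"

text \<open>A chart is a pair of its domain \<open>U\<close> and its coordinate map \<open>\<phi>\<close>; only the values of \<open>\<phi>\<close>
  on \<open>U\<close> matter, and \<open>inv_into U \<phi>\<close> is the parametrisation inverse to it.\<close>

type_synonym ('g, 'm) chart = "'g set \<times> ('g \<Rightarrow> 'm)"

definition smooth_atlas :: "('g::topological_space, 'm::euclidean_space) chart set \<Rightarrow> bool" where
  "smooth_atlas A \<longleftrightarrow>
     (\<forall>(U, \<phi>)\<in>A. open U \<and> open (\<phi> ` U) \<and> homeomorphism U (\<phi> ` U) \<phi> (inv_into U \<phi>)) \<and>
     (\<Union>(U, \<phi>)\<in>A. U) = UNIV \<and>
     (\<forall>(U, \<phi>)\<in>A. \<forall>(W, \<psi>)\<in>A. smooth_on (\<phi> ` (U \<inter> W)) (\<psi> \<circ> inv_into U \<phi>))"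

definition prod_atlas :: "('g, 'm) chart set \<Rightarrow> ('h, 'n) chart set \<Rightarrow> ('g \<times> 'h, 'm \<times> 'n) chart set" where
  "prod_atlas A B = {(U \<times> W, map_prod \<phi> \<psi>) | U \<phi> W \<psi>. (U, \<phi>) \<in> A \<and> (W, \<psi>) \<in> B}"

definition smooth_map ::
  "('g::topological_space, 'm::euclidean_space) chart set \<Rightarrow>
   ('h::topological_space, 'n::euclidean_space) chart set \<Rightarrow> ('g \<Rightarrow> 'h) \<Rightarrow> bool" where
  "smooth_map A B F \<longleftrightarrow> continuous_on UNIV F \<and>
     (\<forall>(U, \<phi>)\<in>A. \<forall>(W, \<psi>)\<in>B. smooth_on (\<phi> ` (U \<inter> F -` W)) (\<psi> \<circ> F \<circ> inv_into U \<phi>))"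

definition smooth_fun :: "('g::topological_space, 'm::euclidean_space) chart set \<Rightarrow> ('g \<Rightarrow> real) \<Rightarrow> bool" where
  "smooth_fun A f \<longleftrightarrow> (\<forall>(U, \<phi>)\<in>A. smooth_on (\<phi> ` U) (f \<circ> inv_into U \<phi>))"


section \<open>Tangent vectors and vector fields\<close>

text \<open>A tangent vector at \<open>p\<close> is the operator sending a smooth function to its derivative at \<open>p\<close>
  in the direction that has coordinates \<open>u\<close> in some chart around \<open>p\<close>. Functions that are not
  smooth are sent to \<open>0\<close>, so that equality of tangent vectors is equality of operators on
  smooth functions.\<close>

type_synonym 'g tangent = "('g \<Rightarrow> real) \<Rightarrow> real"

definition coord_tangent ::
  "('g::topological_space, 'm::euclidean_space) chart set \<Rightarrow> ('g, 'm) chart \<Rightarrow> 'g \<Rightarrow> 'm \<Rightarrow> 'g tangent" where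
  "coord_tangent A c p u = (\<lambda>f. if smooth_fun A f
     then frechet_derivative (f \<circ> inv_into (fst c) (snd c)) (at (snd c p)) u else 0)"

definition tangent_space ::
  "('g::topological_space, 'm::euclidean_space) chart set \<Rightarrow> 'g \<Rightarrow> 'g tangent set" where
  "tangent_space A p = {coord_tangent A (U, \<phi>) p u | U \<phi> u. (U, \<phi>) \<in> A \<and> p \<in> U}"

definition push_forward ::
  "('g::topological_space, 'm::euclidean_space) chart set \<Rightarrow> ('g \<Rightarrow> 'g) \<Rightarrow> 'g tangent \<Rightarrow> 'g tangent" where
  "push_forward A F v = (\<lambda>f. if smooth_fun A f then v (f \<circ> F) else 0)"

type_synonym 'g vfield = "'g \<Rightarrow> 'g tangent"

definition vector_fields ::
  "('g::topological_space, 'm::euclidean_space) chart set \<Rightarrow> 'g vfield set" where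
  "vector_fields A = {X. (\<forall>p. X p \<in> tangent_space A p) \<and>
     (\<forall>f. smooth_fun A f \<longrightarrow> smooth_fun A (\<lambda>p. X p f))}"

definition vf_add :: "'g vfield \<Rightarrow> 'g vfield \<Rightarrow> 'g vfield" where
  "vf_add X Y = (\<lambda>p f. X p f + Y p f)"

definition vf_scale :: "('g \<Rightarrow> real) \<Rightarrow> 'g vfield \<Rightarrow> 'g vfield" where
  "vf_scale h X = (\<lambda>p f. h p * X p f)"

definition lincomb3 ::
  "real \<Rightarrow> real \<Rightarrow> real \<Rightarrow> 'g vfield \<Rightarrow> 'g vfield \<Rightarrow> 'g vfield \<Rightarrow> 'g vfield" where
  "lincomb3 a b c X Y Z =
     vf_add (vf_scale (\<lambda>_. a) X) (vf_add (vf_scale (\<lambda>_. b) Y) (vf_scale (\<lambda>_. c) Z))"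

definition lie_bracket :: "'g vfield \<Rightarrow> 'g vfield \<Rightarrow> 'g vfield" where
  "lie_bracket X Y = (\<lambda>p f. X p (\<lambda>q. Y q f) - Y p (\<lambda>q. X q f))"


section \<open>Lorentzian metrics, Levi-Civita connection, curvature\<close>

type_synonym 'g metric = "'g \<Rightarrow> 'g tangent \<Rightarrow> 'g tangent \<Rightarrow> real"

text \<open>A two-tensor is represented by its action on vector fields, with values in functions.\<close>

type_synonym 'g tensor2 = "'g vfield \<Rightarrow> 'g vfield \<Rightarrow> 'g \<Rightarrow> real"

definition metric_tensor :: "'g metric \<Rightarrow> 'g tensor2" where
  "metric_tensor g X Y = (\<lambda>p. g p (X p) (Y p))"

text \<open>Signature \<open>(n-1, 1)\<close>: at every point there is a timelike vector on whose orthogonal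
  complement the metric is positive definite. In particular the metric is nondegenerate.\<close>

definition lorentzian_metric ::
  "('g::topological_space, 'm::euclidean_space) chart set \<Rightarrow> 'g metric \<Rightarrow> bool" where
  "lorentzian_metric A g \<longleftrightarrow>
     (\<forall>p. \<forall>v\<in>tangent_space A p. \<forall>w\<in>tangent_space A p. g p v w = g p w v) \<and>
     (\<forall>p. \<forall>v\<in>tangent_space A p. \<forall>w\<in>tangent_space A p. \<forall>z\<in>tangent_space A p. \<forall>a b.
        g p (\<lambda>f. a * v f + b * w f) z = a * g p v z + b * g p w z) \<and>
     (\<forall>p. \<exists>t\<in>tangent_space A p. g p t t < 0 \<and>
        (\<forall>w\<in>tangent_space A p. g p t w = 0 \<and> w \<noteq> (\<lambda>f. 0) \<longrightarrow> g p w w > 0)) \<and>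
     (\<forall>X\<in>vector_fields A. \<forall>Y\<in>vector_fields A. smooth_fun A (metric_tensor g X Y))"

definition affine_connection ::
  "('g::topological_space, 'm::euclidean_space) chart set \<Rightarrow>
   ('g vfield \<Rightarrow> 'g vfield \<Rightarrow> 'g vfield) \<Rightarrow> bool" where
  "affine_connection A D \<longleftrightarrow>
     (\<forall>X\<in>vector_fields A. \<forall>Y\<in>vector_fields A. D X Y \<in> vector_fields A) \<and>
     (\<forall>X\<in>vector_fields A. \<forall>Y\<in>vector_fields A. \<forall>Z\<in>vector_fields A.
        D (vf_add X Y) Z = vf_add (D X Z) (D Y Z) \<and>
        D X (vf_add Y Z) = vf_add (D X Y) (D X Z)) \<and>
     (\<forall>X\<in>vector_fields A. \<forall>Y\<in>vector_fields A. \<forall>h. smooth_fun A h \<longrightarrow>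
        D (vf_scale h X) Y = vf_scale h (D X Y) \<and>
        D X (vf_scale h Y) = vf_add (vf_scale (\<lambda>p. X p h) Y) (vf_scale h (D X Y)))"

definition levi_civita_connection ::
  "('g::topological_space, 'm::euclidean_space) chart set \<Rightarrow> 'g metric \<Rightarrow>
   ('g vfield \<Rightarrow> 'g vfield \<Rightarrow> 'g vfield) \<Rightarrow> bool" where
  "levi_civita_connection A g D \<longleftrightarrow> affine_connection A D \<and>
     (\<forall>X\<in>vector_fields A. \<forall>Y\<in>vector_fields A.
        (\<lambda>p f. D X Y p f - D Y X p f) = lie_bracket X Y) \<and>
     (\<forall>X\<in>vector_fields A. \<forall>Y\<in>vector_fields A. \<forall>Z\<in>vector_fields A. \<forall>p.
        X p (metric_tensor g Y Z) = metric_tensor g (D X Y) Z p + metric_tensor g Y (D X Z) p)"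

definition curvature ::
  "('g vfield \<Rightarrow> 'g vfield \<Rightarrow> 'g vfield) \<Rightarrow> 'g vfield \<Rightarrow> 'g vfield \<Rightarrow> 'g vfield \<Rightarrow> 'g vfield" where
  "curvature D X Y Z =
     (\<lambda>p f. D X (D Y Z) p f - D Y (D X Z) p f - D (lie_bracket X Y) Z p f)"

definition curvature4 ::
  "'g metric \<Rightarrow> ('g vfield \<Rightarrow> 'g vfield \<Rightarrow> 'g vfield) \<Rightarrow>
   'g vfield \<Rightarrow> 'g vfield \<Rightarrow> 'g vfield \<Rightarrow> 'g vfield \<Rightarrow> 'g \<Rightarrow> real" where
  "curvature4 g D X Y Z W = (\<lambda>p. - metric_tensor g (curvature D X Y Z) W p)"

definition lie_derivative_metric :: "'g metric \<Rightarrow> 'g vfield \<Rightarrow> 'g tensor2" where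
  "lie_derivative_metric g V Y Z = (\<lambda>p. V p (metric_tensor g Y Z)
     - metric_tensor g (lie_bracket V Y) Z p - metric_tensor g Y (lie_bracket V Z) p)"

definition kulkarni_nomizu ::
  "'g tensor2 \<Rightarrow> 'g tensor2 \<Rightarrow> 'g vfield \<Rightarrow> 'g vfield \<Rightarrow> 'g vfield \<Rightarrow> 'g vfield \<Rightarrow> 'g \<Rightarrow> real" where
  "kulkarni_nomizu T1 T2 X Y Z W = (\<lambda>p.
       T1 X W p * T2 Y Z p + T1 Y Z p * T2 X W p
     - T1 X Z p * T2 Y W p - T1 Y W p * T2 X Z p)"


section \<open>Lie groups and left-invariant Riemann solitons\<close>

text \<open>The underlying set of the group is the whole type, whose topology is the manifold topology.\<close>

definition lie_group ::
  "('g::{t2_space, second_countable_topology}) monoid \<Rightarrow> ('g, 'm::euclidean_space) chart set \<Rightarrow> bool" where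
  "lie_group G A \<longleftrightarrow> group G \<and> carrier G = UNIV \<and> smooth_atlas A \<and>
     smooth_map (prod_atlas A A) A (\<lambda>(x, y). x \<otimes>\<^bsub>G\<^esub> y) \<and>
     smooth_map A A (\<lambda>x. inv\<^bsub>G\<^esub> x)"

text \<open>The Lie algebra of \<open>G\<close>, as the left-invariant vector fields.\<close>

definition left_invariant_fields ::
  "('g::topological_space) monoid \<Rightarrow> ('g, 'm::euclidean_space) chart set \<Rightarrow> 'g vfield set" where
  "left_invariant_fields G A = {X \<in> vector_fields A.
     \<forall>a p. push_forward A (\<lambda>x. a \<otimes>\<^bsub>G\<^esub> x) (X p) = X (a \<otimes>\<^bsub>G\<^esub> p)}"

definition lie_algebra_basis3 ::
  "('g::topological_space) monoid \<Rightarrow> ('g, 'm::euclidean_space) chart set \<Rightarrow>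
   'g vfield \<Rightarrow> 'g vfield \<Rightarrow> 'g vfield \<Rightarrow> bool" where
  "lie_algebra_basis3 G A E1 E2 E3 \<longleftrightarrow>
     E1 \<in> left_invariant_fields G A \<and> E2 \<in> left_invariant_fields G A \<and>
     E3 \<in> left_invariant_fields G A \<and>
     (\<forall>X\<in>left_invariant_fields G A. \<exists>a b c. X = lincomb3 a b c E1 E2 E3) \<and>
     (\<forall>a b c. lincomb3 a b c E1 E2 E3 = (\<lambda>p f. 0) \<longrightarrow> a = 0 \<and> b = 0 \<and> c = 0)"

definition left_invariant_metric ::
  "('g::topological_space) monoid \<Rightarrow> ('g, 'm::euclidean_space) chart set \<Rightarrow> 'g metric \<Rightarrow> bool" where
  "left_invariant_metric G A g \<longleftrightarrow>
     (\<forall>a p. \<forall>v\<in>tangent_space A p. \<forall>w\<in>tangent_space A p.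
        g (a \<otimes>\<^bsub>G\<^esub> p) (push_forward A (\<lambda>x. a \<otimes>\<^bsub>G\<^esub> x) v) (push_forward A (\<lambda>x. a \<otimes>\<^bsub>G\<^esub> x) w)
        = g p v w)"

definition pseudo_orthonormal3 :: "'g metric \<Rightarrow> 'g vfield \<Rightarrow> 'g vfield \<Rightarrow> 'g vfield \<Rightarrow> bool" where
  "pseudo_orthonormal3 g E1 E2 E3 \<longleftrightarrow>
     metric_tensor g E1 E1 = (\<lambda>_. 1) \<and> metric_tensor g E2 E2 = (\<lambda>_. 1) \<and>
     metric_tensor g E3 E3 = (\<lambda>_. -1) \<and> metric_tensor g E1 E2 = (\<lambda>_. 0) \<and>
     metric_tensor g E1 E3 = (\<lambda>_. 0) \<and> metric_tensor g E2 E3 = (\<lambda>_. 0)"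

text \<open>Here \<open>D\<close> is meant to be the Levi-Civita connection of \<open>g\<close>.\<close>

definition left_invariant_riemann_soliton ::
  "('g::topological_space) monoid \<Rightarrow> ('g, 'm::euclidean_space) chart set \<Rightarrow> 'g metric \<Rightarrow>
   ('g vfield \<Rightarrow> 'g vfield \<Rightarrow> 'g vfield) \<Rightarrow> 'g vfield \<Rightarrow> real \<Rightarrow> bool" where
  "left_invariant_riemann_soliton G A g D V lam \<longleftrightarrow> V \<in> left_invariant_fields G A \<and>
     (\<forall>X\<in>vector_fields A. \<forall>Y\<in>vector_fields A. \<forall>Z\<in>vector_fields A. \<forall>W\<in>vector_fields A. \<forall>p.
        curvature4 g D X Y Z W p
          + 1/2 * kulkarni_nomizu (lie_derivative_metric g V) (metric_tensor g) X Y Z W p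
        = lam/2 * kulkarni_nomizu (metric_tensor g) (metric_tensor g) X Y Z W p)"

end

theory Submission
  imports Defs
begin

text \<open>The Leibniz terms cancel in
  \<open>R(X,Y)Z = D\<^sub>X D\<^sub>Y Z - D\<^sub>Y D\<^sub>X Z - D\<^bsub>[X,Y]\<^esub> Z\<close> and in
  \<open>(L\<^sub>V g)(Y,Z) = g(D\<^sub>Y V, Z) + g(Y, D\<^sub>Z V)\<close>, so the soliton equation is linear over smooth
  functions in each argument. A pseudo-orthonormal frame spans every tangent space with smooth
  coefficients \<open>\<plusminus>g(X, e\<^sub>i)\<close>, hence it suffices to test the equation on the frame. There
  Koszul's formula expresses the connection by the structure constants, and what remains is a
  system of six polynomial equations. Two of them force \<open>\<lambda> = \<alpha>\<^sup>2/4\<close> and one becomes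
  \<open>\<alpha>(\<alpha> - \<beta> + \<eta>) = 0\<close>, which is the case distinction of the theorem.\<close>

section \<open>Smooth functions and tangent spaces\<close>

lemma Ck_on_cong:
  assumes "open S" "\<And>x. x \<in> S \<Longrightarrow> f x = h x" "Ck_on k S f"
  shows "Ck_on k S h"
  using assms(2,3)
proof (induction k arbitrary: f h)
  case 0
  then show ?case by (simp cong: continuous_on_cong)
next
  case (Suc k)
  have d: "(h has_derivative frechet_derivative f (at x)) (at x)" if "x \<in> S" for x
  proof -
    have "(f has_derivative frechet_derivative f (at x)) (at x)"
      using Suc.prems that by (simp add: frechet_derivative_works)
    then show ?thesis
      \<comment> \<open>Since \<open>S\<close> is open, agreement on \<open>S\<close> is agreement
        near \<open>x\<close>, and this determines the derivative.\<close>
      by (rule has_derivative_transform_within_open[OF _ assms(1) that]) (use Suc.prems in auto)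
  qed
  have eq: "frechet_derivative f (at x) = frechet_derivative h (at x)" if "x \<in> S" for x
    using frechet_derivative_at[OF d[OF that]] .
  show ?case
    using d Suc.IH[of "\<lambda>x. frechet_derivative f (at x) v" "\<lambda>x. frechet_derivative h (at x) v" for v]
      Suc.prems(2) eq
    by (auto simp: differentiable_def)
qed

text \<open>Differentiability gives continuity at the bottom level. The product rule needs this,
  because it leaves one factor undifferentiated.\<close>

lemma Ck_on_Suc_imp: "Ck_on (Suc k) S f \<Longrightarrow> Ck_on k S f"
proof (induction k arbitrary: f)
  case 0
  then show ?case
    by (auto intro!: differentiable_imp_continuous_on
        simp: differentiable_on_def differentiable_at_withinI)
qed auto

lemma Ck_on_const [simp]: "Ck_on k S (\<lambda>x. c)"
  by (induction k arbitrary: c) auto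

lemma frechet_derivative_add:
  assumes "f differentiable (at x)" "h differentiable (at x)"
  shows "frechet_derivative (\<lambda>x. f x + h x) (at x) v
    = frechet_derivative f (at x) v + frechet_derivative h (at x) v"
proof -
  have "((\<lambda>x. f x + h x) has_derivative (\<lambda>v. frechet_derivative f (at x) v
      + frechet_derivative h (at x) v)) (at x)"
    using assms by (auto intro: has_derivative_add simp: frechet_derivative_works[symmetric])
  from frechet_derivative_at[OF this] show ?thesis by metis
qed

lemma Ck_on_add:
  assumes "open S" "Ck_on k S f" "Ck_on k S h"
  shows "Ck_on k S (\<lambda>x. f x + h x)"
  using assms(2,3)
proof (induction k arbitrary: f h)
  case (Suc k)
  have "Ck_on k S (\<lambda>x. frechet_derivative (\<lambda>x. f x + h x) (at x) v)" for v
    by (rule Ck_on_cong[OF assms(1) _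
          Suc.IH[of "\<lambda>x. frechet_derivative f (at x) v" "\<lambda>x. frechet_derivative h (at x) v"]])
      (use Suc.prems in \<open>auto simp: frechet_derivative_add\<close>)
  then show ?case using Suc.prems by auto
qed (auto intro: continuous_intros)

lemma frechet_derivative_mult:
  fixes f h :: "'a::euclidean_space \<Rightarrow> real"
  assumes "f differentiable (at x)" "h differentiable (at x)"
  shows "frechet_derivative (\<lambda>x. f x * h x) (at x) v
    = f x * frechet_derivative h (at x) v + frechet_derivative f (at x) v * h x"
proof -
  have "((\<lambda>x. f x * h x) has_derivative (\<lambda>v. f x * frechet_derivative h (at x) v
      + frechet_derivative f (at x) v * h x)) (at x)"
    using assms by (auto intro: has_derivative_mult simp: frechet_derivative_works[symmetric])
  from frechet_derivative_at[OF this] show ?thesis by metis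
qed

lemma Ck_on_mult:
  fixes f h :: "'a::euclidean_space \<Rightarrow> real"
  assumes "open S" "Ck_on k S f" "Ck_on k S h"
  shows "Ck_on k S (\<lambda>x. f x * h x)"
  using assms(2,3)
proof (induction k arbitrary: f h)
  case (Suc k)
  have "Ck_on k S (\<lambda>x. f x * frechet_derivative h (at x) v + frechet_derivative f (at x) v * h x)" for v
    \<comment> \<open>The undifferentiated factors are of class \<open>Suc k\<close> and have to be
      lowered to class \<open>k\<close> before the induction hypothesis applies.\<close>
    using Suc.prems by (intro Ck_on_add assms(1) Suc.IH) (use Ck_on_Suc_imp[of k S f] Ck_on_Suc_imp[of k S h] in auto)
  then have "Ck_on k S (\<lambda>x. frechet_derivative (\<lambda>x. f x * h x) (at x) v)" for v
    by (rule Ck_on_cong[OF assms(1), rotated]) (use Suc.prems in \<open>auto simp: frechet_derivative_mult\<close>)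
  then show ?case using Suc.prems by auto
qed (auto intro: continuous_intros)

lemma smooth_atlas_open: "smooth_atlas A \<Longrightarrow> (U, \<phi>) \<in> A \<Longrightarrow> open (\<phi> ` U)"
  unfolding smooth_atlas_def by blast

lemma smooth_atlas_inv_into: "smooth_atlas A \<Longrightarrow> (U, \<phi>) \<in> A \<Longrightarrow> x \<in> U \<Longrightarrow> inv_into U \<phi> (\<phi> x) = x"
  unfolding smooth_atlas_def homeomorphism_def by blast

lemma smooth_fun_const [simp]: "smooth_fun A (\<lambda>x. c)"
  by (auto simp: smooth_fun_def smooth_on_def o_def)

lemma smooth_fun_add:
  assumes "smooth_atlas A" "smooth_fun A f" "smooth_fun A h"
  shows "smooth_fun A (\<lambda>x. f x + h x)"
proof -
  have "Ck_on k (\<phi> ` U) (\<lambda>y. f (inv_into U \<phi> y) + h (inv_into U \<phi> y))" if "(U, \<phi>) \<in> A" for U \<phi> k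
    using that assms(2,3) smooth_atlas_open[OF assms(1) that]
    unfolding smooth_fun_def smooth_on_def o_def by (intro Ck_on_add) auto
  then show ?thesis unfolding smooth_fun_def smooth_on_def o_def by blast
qed

lemma smooth_fun_mult:
  assumes "smooth_atlas A" "smooth_fun A f" "smooth_fun A h"
  shows "smooth_fun A (\<lambda>x. f x * h x)"
proof -
  have "Ck_on k (\<phi> ` U) (\<lambda>y. f (inv_into U \<phi> y) * h (inv_into U \<phi> y))" if "(U, \<phi>) \<in> A" for U \<phi> k
    using that assms(2,3) smooth_atlas_open[OF assms(1) that]
    unfolding smooth_fun_def smooth_on_def o_def by (intro Ck_on_mult) auto
  then show ?thesis unfolding smooth_fun_def smooth_on_def o_def by blast
qed

lemma smooth_fun_differentiable:
  assumes "smooth_fun A f" "(U, \<phi>) \<in> A" "p \<in> U"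
  shows "(f \<circ> inv_into U \<phi>) differentiable (at (\<phi> p))"
proof -
  have "Ck_on (Suc 0) (\<phi> ` U) (f \<circ> inv_into U \<phi>)"
    using assms unfolding smooth_fun_def smooth_on_def by blast
  then show ?thesis using assms(3) by simp
qed

section \<open>Tangent vectors in coordinates\<close>

lemma tangent_space_cases:
  assumes "v \<in> tangent_space A p"
  obtains U \<phi> u where "(U, \<phi>) \<in> A" "p \<in> U" "v = coord_tangent A (U, \<phi>) p u"
  using assms unfolding tangent_space_def by blast

text \<open>Makes the Leibniz terms of constant coefficients vanish, and likewise the derivatives of
  the constant inner products of a frame.\<close>

lemma tangent_const [simp]: "v \<in> tangent_space A p \<Longrightarrow> v (\<lambda>x. c) = 0"
  by (auto simp: tangent_space_def coord_tangent_def o_def)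

lemma coord_tangent_linear:
  assumes "(U, \<phi>) \<in> A" "p \<in> U"
  shows "coord_tangent A (U, \<phi>) p (a *\<^sub>R u + b *\<^sub>R w)
    = (\<lambda>f. a * coord_tangent A (U, \<phi>) p u f + b * coord_tangent A (U, \<phi>) p w f)"
proof
  fix f
  show "coord_tangent A (U, \<phi>) p (a *\<^sub>R u + b *\<^sub>R w) f
    = a * coord_tangent A (U, \<phi>) p u f + b * coord_tangent A (U, \<phi>) p w f"
  proof (cases "smooth_fun A f")
    case True
    interpret linear "frechet_derivative (f \<circ> inv_into U \<phi>) (at (\<phi> p))"
      using smooth_fun_differentiable[OF True assms] by (rule linear_frechet_derivative)
    show ?thesis using True by (simp add: coord_tangent_def add scaleR)
  qed (simp add: coord_tangent_def)
qed

text \<open>The chain rule for the transition map makes every chart around \<open>p\<close> parametrise the whole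
  tangent space.\<close>

lemma tangent_space_eq_range:
  assumes A: "smooth_atlas A" and U: "(U, \<phi>) \<in> A" "p \<in> U"
  shows "tangent_space A p = range (coord_tangent A (U, \<phi>) p)"
proof
  show "range (coord_tangent A (U, \<phi>) p) \<subseteq> tangent_space A p"
    using U by (auto simp: tangent_space_def)
next
  show "tangent_space A p \<subseteq> range (coord_tangent A (U, \<phi>) p)"
  proof
    fix v assume "v \<in> tangent_space A p"
    then obtain W \<psi> u where W: "(W, \<psi>) \<in> A" "p \<in> W" and v: "v = coord_tangent A (W, \<psi>) p u"
      by (rule tangent_space_cases)
    let ?T = "\<phi> \<circ> inv_into W \<psi>"
    let ?S = "\<psi> ` (W \<inter> U)"
    have hom: "homeomorphism W (\<psi> ` W) \<psi> (inv_into W \<psi>)" and oW: "open (\<psi> ` W)" and oU: "open U"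
      using A U W unfolding smooth_atlas_def by blast+
    have "openin (top_of_set (\<psi> ` W)) ?S"
      using homeomorphism_imp_open_map[OF hom] oU by (simp add: openin_open_Int)
    then have oS: "open ?S" using oW by (simp add: openin_open_eq)
    have pS: "\<psi> p \<in> ?S" using U W by blast
    have "Ck_on (Suc 0) ?S ?T"
      using A U W unfolding smooth_atlas_def smooth_on_def by blast
    then have "?T differentiable (at (\<psi> p))" using pS by (simp only: Ck_on.simps)
    then have T: "(?T has_derivative frechet_derivative ?T (at (\<psi> p))) (at (\<psi> p))"
      by (simp add: frechet_derivative_works)
    have Tp: "?T (\<psi> p) = \<phi> p" by (simp add: smooth_atlas_inv_into[OF A W])
    have "v = coord_tangent A (U, \<phi>) p (frechet_derivative ?T (at (\<psi> p)) u)"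
    proof
      fix f
      show "v f = coord_tangent A (U, \<phi>) p (frechet_derivative ?T (at (\<psi> p)) u) f"
      proof (cases "smooth_fun A f")
        case True
        let ?F = "f \<circ> inv_into U \<phi>"
        have "(?F has_derivative frechet_derivative ?F (at (\<phi> p))) (at (\<phi> p))"
          using smooth_fun_differentiable[OF True U] by (simp add: frechet_derivative_works)
        then have "(?F \<circ> ?T has_derivative
            frechet_derivative ?F (at (\<phi> p)) \<circ> frechet_derivative ?T (at (\<psi> p))) (at (\<psi> p))"
          using T Tp by (intro diff_chain_at) auto
        \<comment> \<open>The composite passes through the chart \<open>U\<close>, so it agrees with
          the expression in the chart \<open>W\<close> only over the overlap \<open>?S\<close>, an
          open neighbourhood of the point.\<close>
        then have "(f \<circ> inv_into W \<psi> has_derivative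
            frechet_derivative ?F (at (\<phi> p)) \<circ> frechet_derivative ?T (at (\<psi> p))) (at (\<psi> p))"
          by (rule has_derivative_transform_within_open[OF _ oS pS])
            (auto simp: smooth_atlas_inv_into[OF A W(1)] smooth_atlas_inv_into[OF A U(1)])
        from frechet_derivative_at[OF this, symmetric] show ?thesis
          by (simp add: v coord_tangent_def True)
      qed (simp add: v coord_tangent_def)
    qed
    then show "v \<in> range (coord_tangent A (U, \<phi>) p)" by blast
  qed
qed

lemma smooth_atlas_chart:
  assumes "smooth_atlas A"
  obtains U \<phi> where "(U, \<phi>) \<in> A" "p \<in> U"
  using assms unfolding smooth_atlas_def by blast

text \<open>By \<open>tangent_space_eq_range\<close> both vectors have coordinates in one common
  chart, where the combination is taken.\<close>

lemma tangent_space_lincomb: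
  assumes "smooth_atlas A" "v \<in> tangent_space A p" "w \<in> tangent_space A p"
  shows "(\<lambda>f. a * v f + b * w f) \<in> tangent_space A p"
proof -
  obtain U \<phi> where c: "(U, \<phi>) \<in> A" "p \<in> U" by (rule smooth_atlas_chart[OF assms(1)])
  then show ?thesis
    using assms(2,3) unfolding tangent_space_eq_range[OF assms(1) c]
    by (auto simp flip: coord_tangent_linear[OF c])
qed

text \<open>A dimension count: the coordinates of the three vectors define an endomorphism
  \<open>L\<close> of \<open>real^3\<close>. Independence makes it injective, hence surjective, so
  it reaches the coordinates of \<open>v\<close>.\<close>

lemma tangent_space_basis:
  fixes A :: "('g::topological_space, real^3) chart set"
  assumes A: "smooth_atlas A"
    and t: "t1 \<in> tangent_space A p" "t2 \<in> tangent_space A p" "t3 \<in> tangent_space A p"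
    and indep: "\<And>a b c. (\<And>f. a * t1 f + b * t2 f + c * t3 f = 0) \<Longrightarrow> a = 0 \<and> b = 0 \<and> c = 0"
    and v: "v \<in> tangent_space A p"
  obtains a b c where "v = (\<lambda>f. a * t1 f + b * t2 f + c * t3 f)"
proof -
  obtain U \<phi> where c: "(U, \<phi>) \<in> A" "p \<in> U" by (rule smooth_atlas_chart[OF A])
  let ?C = "coord_tangent A (U, \<phi>) p"
  obtain u1 u2 u3 u where u: "t1 = ?C u1" "t2 = ?C u2" "t3 = ?C u3" "v = ?C u"
    using t v unfolding tangent_space_eq_range[OF A c] by blast
  define L where "L = (\<lambda>x :: real^3. x$1 *\<^sub>R u1 + x$2 *\<^sub>R u2 + x$3 *\<^sub>R u3)"
  have C: "?C (L x) f = x$1 * t1 f + x$2 * t2 f + x$3 * t3 f" for x f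
    using coord_tangent_linear[OF c, of 1 "x$1 *\<^sub>R u1 + x$2 *\<^sub>R u2" "x$3" u3]
      coord_tangent_linear[OF c, of "x$1" u1 "x$2" u2]
    by (simp add: L_def u)
  have C0: "?C 0 f = 0" for f using coord_tangent_linear[OF c, of 0 0 0 0] by simp
  have lin: "linear L" by (rule linearI) (auto simp: L_def algebra_simps)
  have "inj L"
    unfolding linear_injective_0[OF lin]
  proof (intro allI impI)
    fix x assume "L x = 0"
    then have "x$1 = 0 \<and> x$2 = 0 \<and> x$3 = 0" using C[of x] C0 by (intro indep) simp
    then show "x = 0" by (simp add: vec_eq_iff forall_3)
  qed
  then have "surj L" using lin by (simp add: linear_injective_imp_surjective)
  then obtain x where "u = L x" by blast
  then show thesis using C that[of "x$1" "x$2" "x$3"] by (auto simp: u)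
qed

section \<open>Vector fields as a module over the smooth functions\<close>

lemma vector_fields_tangent: "X \<in> vector_fields A \<Longrightarrow> X p \<in> tangent_space A p"
  by (simp add: vector_fields_def)

lemma vector_fields_smooth: "X \<in> vector_fields A \<Longrightarrow> smooth_fun A f \<Longrightarrow> smooth_fun A (\<lambda>p. X p f)"
  by (simp add: vector_fields_def)

lemma vf_add_vector_fields:
  assumes "smooth_atlas A" "X \<in> vector_fields A" "Y \<in> vector_fields A"
  shows "vf_add X Y \<in> vector_fields A"
  using assms tangent_space_lincomb[OF assms(1), of _ _ _ 1 1]
  by (auto simp: vector_fields_def vf_add_def smooth_fun_add)

lemma vf_scale_vector_fields:
  assumes "smooth_atlas A" "X \<in> vector_fields A" "smooth_fun A h"
  shows "vf_scale h X \<in> vector_fields A"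
  using assms tangent_space_lincomb[OF assms(1) vector_fields_tangent[OF assms(2)]
      vector_fields_tangent[OF assms(2)], where b = 0]
  by (auto simp: vector_fields_def vf_scale_def smooth_fun_mult)

lemma vf_apply: "vf_add X Y p f = X p f + Y p f" "vf_scale h X p f = h p * X p f"
  by (simp_all add: vf_add_def vf_scale_def)

text \<open>\<open>push_forward\<close> is linear in the tangent vector. This supplies the
  left-invariance of the field \<open>V\<close> that the definition of a soliton demands.\<close>

lemma left_invariant_fields_lincomb3:
  assumes "smooth_atlas A" "X \<in> left_invariant_fields G A" "Y \<in> left_invariant_fields G A"
    "Z \<in> left_invariant_fields G A"
  shows "lincomb3 a b c X Y Z \<in> left_invariant_fields G A"
proof -
  have "push_forward A F (lincomb3 a b c X Y Z p) = (\<lambda>f. a * push_forward A F (X p) f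
      + (b * push_forward A F (Y p) f + c * push_forward A F (Z p) f))" for F p
    by (simp add: push_forward_def lincomb3_def vf_apply fun_eq_iff)
  then show ?thesis
    using assms
    by (simp add: left_invariant_fields_def vf_add_vector_fields vf_scale_vector_fields
        lincomb3_def vf_apply fun_eq_iff)
qed

section \<open>Tensoriality of the soliton equation\<close>

text \<open>Tensoriality is independent of the dimension; the coordinate space becomes
  \<open>real^3\<close> only once a frame is fixed.\<close>

locale lorentzian_manifold =
  fixes A :: "('g::topological_space, 'm::euclidean_space) chart set"
    and g :: "'g metric"
    and D :: "'g vfield \<Rightarrow> 'g vfield \<Rightarrow> 'g vfield"
  assumes atlas: "smooth_atlas A"
    and lorentzian: "lorentzian_metric A g"
    and levi_civita: "levi_civita_connection A g D"
begin

abbreviation "VF \<equiv> vector_fields A"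
abbreviation "SF \<equiv> smooth_fun A"

lemmas closure [simp] =
  vf_add_vector_fields[OF atlas] vf_scale_vector_fields[OF atlas]
  smooth_fun_add[OF atlas] smooth_fun_mult[OF atlas] vector_fields_smooth

lemma lincomb3_closed [simp]:
  "X \<in> VF \<Longrightarrow> Y \<in> VF \<Longrightarrow> Z \<in> VF \<Longrightarrow> lincomb3 a b c X Y Z \<in> VF"
  by (simp add: lincomb3_def)

section \<open>Rules for the metric and the connection\<close>

lemma metric_smooth [simp]: "X \<in> VF \<Longrightarrow> Y \<in> VF \<Longrightarrow> SF (metric_tensor g X Y)"
  using lorentzian by (simp add: lorentzian_metric_def)

lemma metric_commute: "X \<in> VF \<Longrightarrow> Y \<in> VF \<Longrightarrow> metric_tensor g X Y p = metric_tensor g Y X p"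
  using lorentzian by (simp add: lorentzian_metric_def metric_tensor_def vector_fields_tangent)

lemma metric_pointwise_linear:
  assumes "v \<in> tangent_space A p" "w \<in> tangent_space A p" "z \<in> tangent_space A p"
  shows "g p (\<lambda>f. a * v f + b * w f) z = a * g p v z + b * g p w z"
  using lorentzian assms by (simp add: lorentzian_metric_def)

lemma metric_add_left:
  assumes "X \<in> VF" "Y \<in> VF" "Z \<in> VF"
  shows "metric_tensor g (vf_add X Y) Z p = metric_tensor g X Z p + metric_tensor g Y Z p"
  using metric_pointwise_linear[of "X p" p "Y p" "Z p" 1 1] assms
  by (simp add: metric_tensor_def vf_add_def vector_fields_tangent)

lemma metric_scale_left:
  assumes "X \<in> VF" "Z \<in> VF"
  shows "metric_tensor g (vf_scale h X) Z p = h p * metric_tensor g X Z p"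
  using metric_pointwise_linear[of "X p" p "X p" "Z p" "h p" 0] assms
  by (simp add: metric_tensor_def vf_scale_def vector_fields_tangent)

lemma metric_add_right:
  assumes "X \<in> VF" "Y \<in> VF" "Z \<in> VF"
  shows "metric_tensor g Z (vf_add X Y) p = metric_tensor g Z X p + metric_tensor g Z Y p"
  using assms by (simp add: metric_commute[of Z] metric_add_left)

text \<open>Obtained by symmetry, which \<open>metric_commute\<close> provides for vector fields;
  smoothness of \<open>h\<close> makes the scaled field one.\<close>

lemma metric_scale_right:
  assumes "X \<in> VF" "Z \<in> VF" "SF h"
  shows "metric_tensor g Z (vf_scale h X) p = h p * metric_tensor g Z X p"
  using assms by (simp add: metric_commute[of Z] metric_scale_left)

lemmas metric_linear = metric_add_left metric_scale_left metric_add_right metric_scale_right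

lemma connection_closed [simp]: "X \<in> VF \<Longrightarrow> Y \<in> VF \<Longrightarrow> D X Y \<in> VF"
  using levi_civita by (simp add: levi_civita_connection_def affine_connection_def)

lemma connection_add_left:
  "X \<in> VF \<Longrightarrow> Y \<in> VF \<Longrightarrow> Z \<in> VF \<Longrightarrow> D (vf_add X Y) Z = vf_add (D X Z) (D Y Z)"
  using levi_civita by (simp add: levi_civita_connection_def affine_connection_def)

lemma connection_add_right:
  "X \<in> VF \<Longrightarrow> Y \<in> VF \<Longrightarrow> Z \<in> VF \<Longrightarrow> D Z (vf_add X Y) = vf_add (D Z X) (D Z Y)"
  using levi_civita by (simp add: levi_civita_connection_def affine_connection_def)

lemma connection_scale_left:
  "X \<in> VF \<Longrightarrow> Z \<in> VF \<Longrightarrow> SF h \<Longrightarrow> D (vf_scale h X) Z = vf_scale h (D X Z)"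
  using levi_civita by (simp add: levi_civita_connection_def affine_connection_def)

lemma connection_scale_right:
  "X \<in> VF \<Longrightarrow> Z \<in> VF \<Longrightarrow> SF h \<Longrightarrow>
    D Z (vf_scale h X) = vf_add (vf_scale (\<lambda>p. Z p h) X) (vf_scale h (D Z X))"
  using levi_civita by (simp add: levi_civita_connection_def affine_connection_def)

lemmas connection_rules =
  connection_add_left connection_scale_left connection_add_right connection_scale_right

text \<open>Written with \<open>vf_add\<close> and \<open>vf_scale\<close>, the bracket is visibly a
  vector field and can be expanded by \<open>metric_linear\<close> and
  \<open>connection_rules\<close>.\<close>

lemma torsion_free:
  "X \<in> VF \<Longrightarrow> Y \<in> VF \<Longrightarrow> lie_bracket X Y = vf_add (D X Y) (vf_scale (\<lambda>_. -1) (D Y X))"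
  using levi_civita unfolding levi_civita_connection_def vf_add_def vf_scale_def
  by (auto simp: fun_eq_iff)

lemma metric_compatible:
  "X \<in> VF \<Longrightarrow> Y \<in> VF \<Longrightarrow> Z \<in> VF \<Longrightarrow>
    X p (metric_tensor g Y Z) = metric_tensor g (D X Y) Z p + metric_tensor g Y (D X Z) p"
  using levi_civita unfolding levi_civita_connection_def by blast

section \<open>Linearity over the ring of smooth functions\<close>

definition tensorial :: "('g vfield \<Rightarrow> 'g \<Rightarrow> real) \<Rightarrow> bool" where
  "tensorial S \<longleftrightarrow> (\<forall>X\<in>VF. \<forall>Y\<in>VF. \<forall>p. S (vf_add X Y) p = S X p + S Y p) \<and>
     (\<forall>X\<in>VF. \<forall>h. SF h \<longrightarrow> (\<forall>p. S (vf_scale h X) p = h p * S X p))"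

text \<open>Homogeneity is a condition at each point, so the coefficients may be any functions; in
  the application they are values of tensors in the other arguments.\<close>

lemma tensorial_lincomb:
  assumes "tensorial S" "tensorial T"
  shows "tensorial (\<lambda>X p. a p * S X p + b p * T X p)"
  using assms by (auto simp: tensorial_def algebra_simps)

lemma tensorial_add: "tensorial S \<Longrightarrow> tensorial T \<Longrightarrow> tensorial (\<lambda>X p. S X p + T X p)"
  using tensorial_lincomb[of S T "\<lambda>_. 1" "\<lambda>_. 1"] by simp

lemma tensorial_diff: "tensorial S \<Longrightarrow> tensorial T \<Longrightarrow> tensorial (\<lambda>X p. S X p - T X p)"
  using tensorial_lincomb[of S T "\<lambda>_. 1" "\<lambda>_. -1"] by simp

lemma tensorial_mult: "tensorial S \<Longrightarrow> tensorial (\<lambda>X p. a p * S X p)"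
  using tensorial_lincomb[of S S a "\<lambda>_. 0"] by simp

lemma tensorial_mult_right: "tensorial S \<Longrightarrow> tensorial (\<lambda>X p. S X p * a p)"
  using tensorial_mult[of S a] by (simp add: mult.commute)

lemma tensorial_metric_left: "Y \<in> VF \<Longrightarrow> tensorial (\<lambda>X. metric_tensor g X Y)"
  by (simp add: tensorial_def metric_linear)

lemma tensorial_metric_right: "Y \<in> VF \<Longrightarrow> tensorial (\<lambda>X. metric_tensor g Y X)"
  by (simp add: tensorial_def metric_linear)

text \<open>Metric compatibility expands the derivative along \<open>V\<close>, and torsion-freeness
  the brackets; the terms \<open>D V Y\<close> and \<open>D V Z\<close> cancel. On the right
  \<open>Y\<close> and \<open>Z\<close> are no longer differentiated.\<close>

lemma lie_derivative_metric_eq: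
  assumes "V \<in> VF" "Y \<in> VF" "Z \<in> VF"
  shows "lie_derivative_metric g V Y Z p
    = metric_tensor g (D Y V) Z p + metric_tensor g Y (D Z V) p"
  using assms by (simp add: lie_derivative_metric_def torsion_free metric_compatible metric_linear)

lemma tensorial_lie_derivative_left:
  "V \<in> VF \<Longrightarrow> Z \<in> VF \<Longrightarrow> tensorial (\<lambda>Y. lie_derivative_metric g V Y Z)"
  by (simp add: tensorial_def lie_derivative_metric_eq metric_linear connection_rules algebra_simps)

lemma tensorial_lie_derivative_right:
  "V \<in> VF \<Longrightarrow> Z \<in> VF \<Longrightarrow> tensorial (\<lambda>Y. lie_derivative_metric g V Z Y)"
  by (simp add: tensorial_def lie_derivative_metric_eq metric_linear connection_rules algebra_simps)

text \<open>The derivative along the bracket is split by torsion-freeness, which leaves an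
  expression in the connection alone, ready for the Leibniz rules.\<close>

lemma curvature_eq:
  assumes "X \<in> VF" "Y \<in> VF" "Z \<in> VF"
  shows "curvature D X Y Z = vf_add (vf_add (D X (D Y Z)) (vf_scale (\<lambda>_. -1) (D Y (D X Z))))
    (vf_add (vf_scale (\<lambda>_. -1) (D (D X Y) Z)) (D (D Y X) Z))"
  using assms
  by (simp add: curvature_def torsion_free connection_rules vf_apply fun_eq_iff)

lemma curvature_closed [simp]: "X \<in> VF \<Longrightarrow> Y \<in> VF \<Longrightarrow> Z \<in> VF \<Longrightarrow> curvature D X Y Z \<in> VF"
  by (simp add: curvature_eq)

lemma curvature_swap:
  assumes "X \<in> VF" "Y \<in> VF" "Z \<in> VF"
  shows "curvature D Y X Z = vf_scale (\<lambda>_. -1) (curvature D X Y Z)"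
  using assms by (simp add: curvature_eq vf_apply fun_eq_iff)

lemma curvature_add1:
  assumes "X \<in> VF" "X' \<in> VF" "Y \<in> VF" "Z \<in> VF"
  shows "curvature D (vf_add X X') Y Z = vf_add (curvature D X Y Z) (curvature D X' Y Z)"
  using assms by (simp add: curvature_eq connection_rules vf_apply fun_eq_iff)

text \<open>The term \<open>Y(h) D X Z\<close> arises twice with opposite signs: from
  differentiating \<open>h D X Z\<close> along \<open>Y\<close>, and from the derivative along
  \<open>D Y (h X)\<close>.\<close>

lemma curvature_scale1:
  assumes "X \<in> VF" "Y \<in> VF" "Z \<in> VF" "SF h"
  shows "curvature D (vf_scale h X) Y Z = vf_scale h (curvature D X Y Z)"
  using assms
  by (simp add: curvature_eq connection_rules vf_apply fun_eq_iff algebra_simps)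

lemma curvature_add3:
  assumes "X \<in> VF" "Y \<in> VF" "Z \<in> VF" "Z' \<in> VF"
  shows "curvature D X Y (vf_add Z Z') = vf_add (curvature D X Y Z) (curvature D X Y Z')"
  using assms by (simp add: curvature_eq connection_rules vf_apply fun_eq_iff)

text \<open>The second derivatives of \<open>h\<close> cancel because the connection is torsion-free.\<close>

lemma curvature_scale3:
  assumes "X \<in> VF" "Y \<in> VF" "Z \<in> VF" "SF h"
  shows "curvature D X Y (vf_scale h Z) = vf_scale h (curvature D X Y Z)"
proof -
  have h: "X p (\<lambda>q. Y q h) - Y p (\<lambda>q. X q h) = D X Y p h - D Y X p h" for p
    using fun_cong[OF fun_cong[OF torsion_free[OF assms(1,2)], of p], of h]
    by (simp add: lie_bracket_def vf_apply)
  show ?thesis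
  proof (intro ext)
    fix p f
    \<comment> \<open>The mixed terms with one derivative on \<open>h\<close> and one on
      \<open>Z\<close> cancel in pairs; what is left is a multiple of \<open>Z\<close>.\<close>
    have "curvature D X Y (vf_scale h Z) p f - vf_scale h (curvature D X Y Z) p f
      = (X p (\<lambda>q. Y q h) - Y p (\<lambda>q. X q h) - (D X Y p h - D Y X p h)) * Z p f"
      using assms
      by (simp add: curvature_eq connection_rules vf_apply algebra_simps)
    then show "curvature D X Y (vf_scale h Z) p f = vf_scale h (curvature D X Y Z) p f"
      using h by simp
  qed
qed

lemma tensorial_curvature4_1:
  "Y \<in> VF \<Longrightarrow> Z \<in> VF \<Longrightarrow> W \<in> VF \<Longrightarrow> tensorial (\<lambda>X. curvature4 g D X Y Z W)"
  by (simp add: tensorial_def curvature4_def curvature_add1 curvature_scale1 metric_linear)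

lemma tensorial_curvature4_3:
  "X \<in> VF \<Longrightarrow> Y \<in> VF \<Longrightarrow> W \<in> VF \<Longrightarrow> tensorial (\<lambda>Z. curvature4 g D X Y Z W)"
  by (simp add: tensorial_def curvature4_def curvature_add3 curvature_scale3 metric_linear)

lemma tensorial_curvature4_4:
  "X \<in> VF \<Longrightarrow> Y \<in> VF \<Longrightarrow> Z \<in> VF \<Longrightarrow> tensorial (\<lambda>W. curvature4 g D X Y Z W)"
  by (simp add: tensorial_def curvature4_def metric_linear)

text \<open>The difference of the two sides, so that being a soliton means the vanishing of one
  tensor.\<close>

definition soliton_defect ::
  "'g vfield \<Rightarrow> real \<Rightarrow> 'g vfield \<Rightarrow> 'g vfield \<Rightarrow> 'g vfield \<Rightarrow> 'g vfield \<Rightarrow> 'g \<Rightarrow> real" where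
  "soliton_defect V lam X Y Z W p = curvature4 g D X Y Z W p
     + 1/2 * kulkarni_nomizu (lie_derivative_metric g V) (metric_tensor g) X Y Z W p
     - lam/2 * kulkarni_nomizu (metric_tensor g) (metric_tensor g) X Y Z W p"

text \<open>All three summands are antisymmetric in the first two arguments. Linearity in the second
  argument thus comes from linearity in the first.\<close>

lemma soliton_defect_swap:
  assumes "X \<in> VF" "Y \<in> VF" "Z \<in> VF" "W \<in> VF"
  shows "soliton_defect V lam Y X Z W p = - soliton_defect V lam X Y Z W p"
  using assms
  by (simp add: soliton_defect_def curvature4_def curvature_swap[of X Y] metric_linear
      kulkarni_nomizu_def algebra_simps)

lemmas tensorial_intros = tensorial_add tensorial_diff tensorial_mult tensorial_mult_right
  tensorial_metric_left tensorial_metric_right tensorial_lie_derivative_left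
  tensorial_lie_derivative_right tensorial_curvature4_1 tensorial_curvature4_3 tensorial_curvature4_4

text \<open>Each argument occurs in exactly one factor of every product in the defect, so the rules
  for sums and multiples suffice here and for the other arguments.\<close>

lemma tensorial_soliton_defect_1:
  "V \<in> VF \<Longrightarrow> Y \<in> VF \<Longrightarrow> Z \<in> VF \<Longrightarrow> W \<in> VF \<Longrightarrow> tensorial (\<lambda>X. soliton_defect V lam X Y Z W)"
  unfolding soliton_defect_def kulkarni_nomizu_def by (intro tensorial_intros)

lemma tensorial_soliton_defect_3:
  "V \<in> VF \<Longrightarrow> X \<in> VF \<Longrightarrow> Y \<in> VF \<Longrightarrow> W \<in> VF \<Longrightarrow> tensorial (\<lambda>Z. soliton_defect V lam X Y Z W)"
  unfolding soliton_defect_def kulkarni_nomizu_def by (intro tensorial_intros)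

lemma tensorial_soliton_defect_4:
  "V \<in> VF \<Longrightarrow> X \<in> VF \<Longrightarrow> Y \<in> VF \<Longrightarrow> Z \<in> VF \<Longrightarrow> tensorial (\<lambda>W. soliton_defect V lam X Y Z W)"
  unfolding soliton_defect_def kulkarni_nomizu_def by (intro tensorial_intros)

section \<open>Expansion of combinations with constant coefficients\<close>

lemma metric_lincomb3_left:
  assumes "X \<in> VF" "Y \<in> VF" "Z \<in> VF" "W \<in> VF"
  shows "metric_tensor g (lincomb3 a b c X Y Z) W p
    = a * metric_tensor g X W p + b * metric_tensor g Y W p + c * metric_tensor g Z W p"
  using assms by (simp add: lincomb3_def metric_linear)

lemma metric_lincomb3_right:
  assumes "X \<in> VF" "Y \<in> VF" "Z \<in> VF" "W \<in> VF"
  shows "metric_tensor g W (lincomb3 a b c X Y Z) p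
    = a * metric_tensor g W X p + b * metric_tensor g W Y p + c * metric_tensor g W Z p"
  using assms by (simp add: lincomb3_def metric_linear)

lemma connection_lincomb3_left:
  assumes "X \<in> VF" "Y \<in> VF" "Z \<in> VF" "W \<in> VF"
  shows "D (lincomb3 a b c X Y Z) W = lincomb3 a b c (D X W) (D Y W) (D Z W)"
  using assms by (simp add: lincomb3_def connection_rules)

lemma connection_lincomb3_right:
  assumes "X \<in> VF" "Y \<in> VF" "Z \<in> VF" "W \<in> VF"
  shows "D W (lincomb3 a b c X Y Z) = lincomb3 a b c (D W X) (D W Y) (D W Z)"
proof -
  have "W p (\<lambda>_. r) = 0" for p r by (rule tangent_const[OF vector_fields_tangent[OF assms(4)]])
  then show ?thesis
    using assms by (simp add: lincomb3_def connection_rules vf_apply fun_eq_iff)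
qed

lemmas lincomb3_rules = metric_lincomb3_left metric_lincomb3_right
  connection_lincomb3_left connection_lincomb3_right

end

section \<open>Orthonormal frames\<close>

locale orthonormal_frame3 = lorentzian_manifold A g D
  for A :: "('g::topological_space, real^3) chart set" and g D +
  fixes e1 e2 e3 :: "'g vfield"
  assumes frame_closed [simp]: "e1 \<in> vector_fields A" "e2 \<in> vector_fields A" "e3 \<in> vector_fields A"
    and orthonormal: "pseudo_orthonormal3 g e1 e2 e3"
begin

lemma frame_metric_const:
  "metric_tensor g e1 e1 = (\<lambda>_. 1)" "metric_tensor g e2 e2 = (\<lambda>_. 1)"
  "metric_tensor g e3 e3 = (\<lambda>_. -1)"
  "metric_tensor g e1 e2 = (\<lambda>_. 0)" "metric_tensor g e1 e3 = (\<lambda>_. 0)"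
  "metric_tensor g e2 e3 = (\<lambda>_. 0)" "metric_tensor g e2 e1 = (\<lambda>_. 0)"
  "metric_tensor g e3 e1 = (\<lambda>_. 0)" "metric_tensor g e3 e2 = (\<lambda>_. 0)"
  using orthonormal metric_commute by (auto simp: pseudo_orthonormal3_def fun_eq_iff)

text \<open>Pairing a vanishing combination with the frame shows independence, so the frame spans
  each tangent space; pairing again gives the coefficients. The minus sign comes from the timelike
  \<open>e3\<close>.\<close>

lemma frame_expansion:
  assumes "X \<in> VF"
  shows "X p f = metric_tensor g X e1 p * e1 p f + metric_tensor g X e2 p * e2 p f
    - metric_tensor g X e3 p * e3 p f"
proof -
  have t: "e1 p \<in> tangent_space A p" "e2 p \<in> tangent_space A p" "e3 p \<in> tangent_space A p"
    by (simp_all add: vector_fields_tangent)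
  have lin: "g p (\<lambda>f. a * e1 p f + b * e2 p f + c * e3 p f) z
      = a * g p (e1 p) z + b * g p (e2 p) z + c * g p (e3 p) z"
    if z: "z \<in> tangent_space A p" for a b c z
    using metric_pointwise_linear[OF tangent_space_lincomb[OF atlas t(1,2)] t(3) z, of 1 a b c]
      metric_pointwise_linear[OF t(1,2) z, of a b]
    by simp
  have orth: "g p (e1 p) (e1 p) = 1" "g p (e2 p) (e2 p) = 1" "g p (e3 p) (e3 p) = -1"
    "g p (e1 p) (e2 p) = 0" "g p (e1 p) (e3 p) = 0" "g p (e2 p) (e3 p) = 0"
    "g p (e2 p) (e1 p) = 0" "g p (e3 p) (e1 p) = 0" "g p (e3 p) (e2 p) = 0"
    using frame_metric_const[THEN fun_cong, of p] by (simp_all add: metric_tensor_def)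
  have indep: "a = 0 \<and> b = 0 \<and> c = 0" if "\<And>f. a * e1 p f + b * e2 p f + c * e3 p f = 0" for a b c
  proof -
    \<comment> \<open>The combination is the zero operator, and \<open>g\<close> vanishes on it by
      the instance of \<open>lin\<close> with zero coefficients.\<close>
    have z: "g p (\<lambda>f. a * e1 p f + b * e2 p f + c * e3 p f) z = 0" if "z \<in> tangent_space A p" for z
      using lin[OF that, of 0 0 0] \<open>\<And>f. a * e1 p f + b * e2 p f + c * e3 p f = 0\<close> by simp
    have "a = 0" using z[OF t(1)] lin[OF t(1), of a b c] by (simp add: orth)
    moreover have "b = 0" using z[OF t(2)] lin[OF t(2), of a b c] by (simp add: orth)
    moreover have "c = 0" using z[OF t(3)] lin[OF t(3), of a b c] by (simp add: orth)
    ultimately show ?thesis by blast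
  qed
  obtain a b c where X: "X p = (\<lambda>f. a * e1 p f + b * e2 p f + c * e3 p f)"
    using tangent_space_basis[OF atlas t indep vector_fields_tangent[OF assms]] by metis
  show ?thesis by (simp add: metric_tensor_def X lin t orth)
qed

lemma frame_eqI:
  assumes "X \<in> VF" "Y \<in> VF" "\<And>p. metric_tensor g X e1 p = metric_tensor g Y e1 p"
    "\<And>p. metric_tensor g X e2 p = metric_tensor g Y e2 p"
    "\<And>p. metric_tensor g X e3 p = metric_tensor g Y e3 p"
  shows "X = Y"
proof (intro ext)
  fix p f
  show "X p f = Y p f"
    unfolding frame_expansion[OF assms(1), of p f] frame_expansion[OF assms(2), of p f]
    by (simp add: assms)
qed

text \<open>The frame is global and the coefficients of \<open>X\<close> in it are smooth functions,
  so \<open>S X p\<close> is a combination of the values of \<open>S\<close> on the frame.\<close>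

lemma tensorial_eq_0:
  assumes S: "tensorial S" and "S e1 p = 0" "S e2 p = 0" "S e3 p = 0" and X: "X \<in> VF"
  shows "S X p = 0"
proof -
  define Y where "Y = vf_add (vf_scale (metric_tensor g X e1) e1)
    (vf_add (vf_scale (metric_tensor g X e2) e2)
      (vf_scale (\<lambda>p. -1 * metric_tensor g X e3 p) e3))"
  \<comment> \<open>The sign stays a factor \<open>-1\<close>, as \<open>smooth_fun_mult\<close>
    expects; \<open>mult_minus1\<close> is switched off below to preserve this form.\<close>
  have sf: "SF (\<lambda>p. -1 * metric_tensor g X e3 p)"
    using X by (intro smooth_fun_mult[OF atlas]) simp_all
  have "X = Y" using frame_expansion[OF X] by (simp add: Y_def vf_apply fun_eq_iff)
  moreover have "S Y p = metric_tensor g X e1 p * S e1 p + (metric_tensor g X e2 p * S e2 p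
    + -1 * metric_tensor g X e3 p * S e3 p)"
    using S X sf unfolding Y_def tensorial_def by (simp del: mult_minus1)
  ultimately show ?thesis using assms by simp
qed

text \<open>Inner products of frame fields are constant, so the derivative terms of Koszul's formula
  drop out and each \<open>D U\<close> is skew on the frame.\<close>

lemma koszul_frame:
  assumes "X \<in> {e1, e2, e3}" "Y \<in> {e1, e2, e3}" "Z \<in> {e1, e2, e3}"
  shows "metric_tensor g (D X Y) Z p = (metric_tensor g (lie_bracket X Y) Z p
    - metric_tensor g (lie_bracket Y Z) X p - metric_tensor g (lie_bracket X Z) Y p) / 2"
proof -
  have VF: "W \<in> VF" if "W \<in> {e1, e2, e3}" for W using that by auto
  have "metric_tensor g (D U W) T p = - metric_tensor g (D U T) W p"
    if "U \<in> {e1, e2, e3}" "W \<in> {e1, e2, e3}" "T \<in> {e1, e2, e3}" for U W T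
  proof -
    have "U p (metric_tensor g W T) = 0"
      using that(2,3) vector_fields_tangent[OF VF[OF that(1)], of p]
      by (auto simp: frame_metric_const)
    then show ?thesis
      using that[THEN VF] metric_compatible[of U W T p] by (simp add: metric_commute[of W])
  qed
  \<comment> \<open>One skew relation for differentiation along each of \<open>X\<close>,
    \<open>Y\<close> and \<open>Z\<close>. Once the brackets are expanded, the first doubles the
    wanted term and the other two cancel the rest.\<close>
  note c = this[OF assms(1,2,3)] this[OF assms(2,1,3)] this[OF assms(3,1,2)]
  show ?thesis
    using c assms[THEN VF] by (simp add: torsion_free metric_linear)
qed

text \<open>Linearity reduces every argument to the frame, and antisymmetry reduces the first two to
  three pairs.\<close>

lemma soliton_defect_eq_0_iff:
  assumes V: "V \<in> VF"
  shows "(\<forall>X\<in>VF. \<forall>Y\<in>VF. \<forall>Z\<in>VF. \<forall>W\<in>VF. \<forall>p. soliton_defect V lam X Y Z W p = 0) \<longleftrightarrow>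
    (\<forall>p. \<forall>Z\<in>{e1, e2, e3}. \<forall>W\<in>{e1, e2, e3}. soliton_defect V lam e1 e2 Z W p = 0 \<and>
      soliton_defect V lam e1 e3 Z W p = 0 \<and> soliton_defect V lam e2 e3 Z W p = 0)"
    (is "?L \<longleftrightarrow> ?R")
proof
  assume ?L
  then have "soliton_defect V lam X Y Z W p = 0"
    if "X \<in> VF" "Y \<in> VF" "Z \<in> {e1, e2, e3}" "W \<in> {e1, e2, e3}" for X Y Z W p
    using that frame_closed by blast
  then show ?R by simp
next
  assume R: ?R
  let ?F = "soliton_defect V lam"
  have swap: "?F Y X Z W p = - ?F X Y Z W p" if "X \<in> VF" "Y \<in> VF" "Z \<in> VF" "W \<in> VF" for X Y Z W p
    using soliton_defect_swap that .
  \<comment> \<open>A number equal to its own negative is zero.\<close>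
  have refl: "?F X X Z W p = 0" if "X \<in> VF" "Z \<in> VF" "W \<in> VF" for X Z W p
    using swap[of X X Z W p] that by simp
  have zero4: "?F X Y Z W p = 0"
    if "X \<in> VF" "Y \<in> VF" "Z \<in> VF" "W \<in> VF" "\<And>W. W \<in> {e1, e2, e3} \<Longrightarrow> ?F X Y Z W p = 0" for X Y Z W p
    using tensorial_eq_0[OF tensorial_soliton_defect_4[OF V that(1-3)] _ _ _ that(4)] that(5) by simp
  have zero3: "?F X Y Z W p = 0"
    if "X \<in> VF" "Y \<in> VF" "Z \<in> VF" "W \<in> VF" "\<And>Z. Z \<in> {e1, e2, e3} \<Longrightarrow> ?F X Y Z W p = 0" for X Y Z W p
    using tensorial_eq_0[OF tensorial_soliton_defect_3[OF V that(1,2,4)] _ _ _ that(3)] that(5) by simp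
  have zero1: "?F X Y Z W p = 0"
    if "X \<in> VF" "Y \<in> VF" "Z \<in> VF" "W \<in> VF" "\<And>X. X \<in> {e1, e2, e3} \<Longrightarrow> ?F X Y Z W p = 0" for X Y Z W p
    using tensorial_eq_0[OF tensorial_soliton_defect_1[OF V that(2-4)] _ _ _ that(1)] that(5) by simp
  have ZW: "?F X Y Z W p = 0"
    if XY: "(X, Y) \<in> {(e1, e2), (e1, e3), (e2, e3)}" and Z: "Z \<in> VF" and W: "W \<in> VF" for X Y Z W p
  proof (rule zero3)
    fix Z' assume Z': "Z' \<in> {e1, e2, e3}"
    show "?F X Y Z' W p = 0"
    proof (rule zero4)
      fix W' assume "W' \<in> {e1, e2, e3}"
      then show "?F X Y Z' W' p = 0" using R XY Z' by blast
    qed (use XY Z' W in auto)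
  qed (use XY Z W in auto)
  have base: "?F X Y Z W p = 0"
    if "X \<in> {e1, e2, e3}" "Y \<in> {e1, e2, e3}" "Z \<in> VF" "W \<in> VF" for X Y Z W p
  proof -
    have "X = Y \<or> (X, Y) \<in> {(e1, e2), (e1, e3), (e2, e3)} \<or> (Y, X) \<in> {(e1, e2), (e1, e3), (e2, e3)}"
      using that(1,2) by blast
    moreover have "X \<in> VF" "Y \<in> VF" using that(1,2) by auto
    ultimately show ?thesis using refl[of X Z W p] swap[of Y X Z W p] ZW that(3,4) by auto
  qed
  have one: "?F X Y Z W p = 0"
    if "X \<in> VF" "Y \<in> {e1, e2, e3}" "Z \<in> VF" "W \<in> VF" for X Y Z W p
  proof (rule zero1)
    show "Y \<in> VF" using that(2) by auto
  qed (use that base in auto)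
  show ?L
  proof (intro ballI allI)
    fix X Y Z W p assume m: "X \<in> VF" "Y \<in> VF" "Z \<in> VF" "W \<in> VF"
    \<comment> \<open>The arguments are exchanged so that the second one, too, can be reduced to the
      frame through the first slot.\<close>
    have "?F Y X Z W p = 0"
    proof (rule zero1)
      fix Y' assume Y': "Y' \<in> {e1, e2, e3}"
      then have "Y' \<in> VF" by auto
      then show "?F Y' X Z W p = 0" using swap[of X Y' Z W p] one[OF m(1) Y' m(3,4), of p] m by simp
    qed (use m in auto)
    then show "?F X Y Z W p = 0" using swap[OF m, of p] by simp
  qed
qed

end

section \<open>The structure constants of the theorem\<close>

locale G4_frame = orthonormal_frame3 A g D e1 e2 e3
  for A :: "('g::topological_space, real^3) chart set" and g D e1 e2 e3 +
  fixes \<alpha> \<beta> \<eta> :: real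
  assumes eta: "\<eta> \<in> {1, -1}"
    and bracket12: "lie_bracket e1 e2 = lincomb3 0 (-1) (2 * \<eta> - \<beta>) e1 e2 e3"
    and bracket13: "lie_bracket e1 e3 = lincomb3 0 (-\<beta>) 1 e1 e2 e3"
    and bracket23: "lie_bracket e2 e3 = lincomb3 \<alpha> 0 0 e1 e2 e3"
begin

lemma bracket_swap:
  assumes "X \<in> VF" "Y \<in> VF" "Z \<in> VF"
  shows "metric_tensor g (lie_bracket Y X) Z p = - metric_tensor g (lie_bracket X Y) Z p"
  using assms by (simp add: torsion_free metric_linear)

lemma bracket_self:
  assumes "X \<in> VF" "Z \<in> VF"
  shows "metric_tensor g (lie_bracket X X) Z p = 0"
  using bracket_swap[of X X Z p] assms by simp

text \<open>By \<open>frame_eqI\<close> only inner products with the frame are compared, and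
  Koszul's formula gives them from the three brackets. The coefficient along \<open>e3\<close> is
  minus the inner product with \<open>e3\<close>.\<close>

lemma frame_connection:
  "D e1 e1 = lincomb3 0 0 0 e1 e2 e3"
  "D e1 e2 = lincomb3 0 0 (\<alpha> / 2 - \<beta> + \<eta>) e1 e2 e3"
  "D e1 e3 = lincomb3 0 (\<alpha> / 2 - \<beta> + \<eta>) 0 e1 e2 e3"
  "D e2 e1 = lincomb3 0 1 (\<alpha> / 2 - \<eta>) e1 e2 e3"
  "D e2 e2 = lincomb3 (-1) 0 0 e1 e2 e3"
  "D e2 e3 = lincomb3 (\<alpha> / 2 - \<eta>) 0 0 e1 e2 e3"
  "D e3 e1 = lincomb3 0 (\<alpha> / 2 + \<eta>) (-1) e1 e2 e3"
  "D e3 e2 = lincomb3 (- \<alpha> / 2 - \<eta>) 0 0 e1 e2 e3"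
  "D e3 e3 = lincomb3 (-1) 0 0 e1 e2 e3"
  by (rule frame_eqI; simp add: koszul_frame bracket_self bracket_swap[of e1 e2]
      bracket_swap[of e1 e3] bracket_swap[of e2 e3] bracket12 bracket13 bracket23
      metric_lincomb3_left frame_metric_const field_simps)+

lemmas frame_simps = soliton_defect_def curvature4_def curvature_eq kulkarni_nomizu_def
  lie_derivative_metric_eq lincomb3_rules frame_connection metric_linear frame_metric_const

text \<open>The second form cancels a square inside a longer product nested to the right.\<close>

lemma eta_square: "\<eta> * \<eta> = 1" "\<eta> * (\<eta> * x) = x"
  using eta by auto

text \<open>The table is that of a symmetric form on the bivectors spanned by the pairs (1,2),
  (1,3), (2,3): \<open>K1\<close> to \<open>K6\<close> are its six independent entries, and the
  values with equal last arguments vanish.\<close>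

lemma soliton_defect_frame:
  fixes v1 v2 v3 lam :: real
  defines "F \<equiv> soliton_defect (lincomb3 v1 v2 v3 e1 e2 e3) lam"
  defines "K1 \<equiv> 2 + lam - \<alpha>\<^sup>2 / 4 + \<alpha> * \<eta> - 2 * \<beta> * \<eta> - v1"
  defines "K2 \<equiv> \<alpha> - 2 * \<beta> + 2 * \<eta> - \<eta> * v1"
  defines "K3 \<equiv> (\<beta> * v2 - \<alpha> * v2 - 2 * \<eta> * v2 - v3) / 2"
  defines "K4 \<equiv> 2 - lam + \<alpha>\<^sup>2 / 4 + \<alpha> * \<eta> - 2 * \<beta> * \<eta> - v1"
  defines "K5 \<equiv> (\<alpha> * v3 - \<beta> * v3 - v2) / 2"
  defines "K6 \<equiv> \<alpha> * \<beta> - \<alpha> * \<eta> - lam - 3 / 4 * \<alpha>\<^sup>2"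
  shows
    "F e1 e2 e1 e1 p = 0" "F e1 e2 e1 e2 p = K1" "F e1 e2 e1 e3 p = K2"
    "F e1 e2 e2 e1 p = - K1" "F e1 e2 e2 e2 p = 0" "F e1 e2 e2 e3 p = K3"
    "F e1 e2 e3 e1 p = - K2" "F e1 e2 e3 e2 p = - K3" "F e1 e2 e3 e3 p = 0"
    "F e1 e3 e1 e1 p = 0" "F e1 e3 e1 e2 p = K2" "F e1 e3 e1 e3 p = K4"
    "F e1 e3 e2 e1 p = - K2" "F e1 e3 e2 e2 p = 0" "F e1 e3 e2 e3 p = K5"
    "F e1 e3 e3 e1 p = - K4" "F e1 e3 e3 e2 p = - K5" "F e1 e3 e3 e3 p = 0"
    "F e2 e3 e1 e1 p = 0" "F e2 e3 e1 e2 p = K3" "F e2 e3 e1 e3 p = K5"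
    "F e2 e3 e2 e1 p = - K3" "F e2 e3 e2 e2 p = 0" "F e2 e3 e2 e3 p = K6"
    "F e2 e3 e3 e1 p = - K5" "F e2 e3 e3 e2 p = - K6" "F e2 e3 e3 e3 p = 0"
  unfolding assms
  by (simp add: frame_simps; simp add: field_simps power2_eq_square eta_square)+

end

text \<open>Sum and difference of the first and fourth equations give \<open>v1\<close> and
  \<open>lam\<close>; the sixth then factors. The third and fifth form a linear system for
  \<open>v2\<close> and \<open>v3\<close>, with determinant
  \<plusminus>\<open>(\<beta> - \<alpha> - \<eta>)^2\<close> because \<eta> squares to 1.\<close>

lemma soliton_equations_iff:
  fixes \<alpha> \<beta> \<eta> v1 v2 v3 lam :: real
  assumes "\<eta> \<in> {1, -1}"
  shows "(2 + lam - \<alpha>\<^sup>2 / 4 + \<alpha> * \<eta> - 2 * \<beta> * \<eta> - v1 = 0 \<and> \<alpha> - 2 * \<beta> + 2 * \<eta> - \<eta> * v1 = 0 \<and>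
      \<beta> * v2 - \<alpha> * v2 - 2 * \<eta> * v2 - v3 = 0 \<and>
      2 - lam + \<alpha>\<^sup>2 / 4 + \<alpha> * \<eta> - 2 * \<beta> * \<eta> - v1 = 0 \<and> \<alpha> * v3 - \<beta> * v3 - v2 = 0 \<and>
      \<alpha> * \<beta> - \<alpha> * \<eta> - lam - 3 / 4 * \<alpha>\<^sup>2 = 0) \<longleftrightarrow>
      (\<beta> \<noteq> \<eta> \<and> \<alpha> = 0 \<and> v1 = 2 - 2 * \<eta> * \<beta> \<and> v2 = 0 \<and> v3 = 0 \<and> lam = 0)
    \<or> (\<alpha> - \<beta> + \<eta> = 0 \<and> v2 = - \<eta> * v3 \<and> v1 = 1 - \<eta> * \<beta> \<and> lam = \<alpha>\<^sup>2 / 4)"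
    (is "?L \<longleftrightarrow> ?R")
proof
  have e: "\<eta> * \<eta> = 1" using assms by auto
  assume ?L
  then have v1: "v1 = 2 + \<alpha> * \<eta> - 2 * \<beta> * \<eta>" and lam: "lam = \<alpha>\<^sup>2 / 4"
    and v3: "v3 = \<beta> * v2 - \<alpha> * v2 - 2 * \<eta> * v2" and v2: "v2 = \<alpha> * v3 - \<beta> * v3"
    and "\<alpha> * \<beta> - \<alpha> * \<eta> - lam - 3 / 4 * \<alpha>\<^sup>2 = 0"
    by linarith+
  then have "\<alpha> * (\<alpha> - \<beta> + \<eta>) = 0" by (simp add: algebra_simps power2_eq_square)
  \<comment> \<open>If \<alpha> = 0 and \<beta> = \<eta>, the first alternative already applies, so
    the second may exclude this equality.\<close>
  then consider "\<alpha> - \<beta> + \<eta> = 0" | "\<alpha> = 0" "\<beta> \<noteq> \<eta>" by force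
  then show ?R
  proof cases
    case 1
    then have b: "\<beta> = \<alpha> + \<eta>" by simp
    have "v2 = - \<eta> * v3" using v2 by (simp add: b algebra_simps)
    moreover have "v1 = 1 - \<eta> * \<beta>" using v1 e by (simp add: b algebra_simps)
    ultimately show ?thesis using 1 lam by blast
  next
    case 2
    \<comment> \<open>Eliminating \<open>v3\<close> leaves
      \<open>v2 * (1 + \<beta> * (\<beta> - 2 * \<eta>)) = 0\<close>, and the bracket is the square
      of \<beta> - \<eta>, which is nonzero here.\<close>
    have "v2 * (\<beta> - \<eta>)\<^sup>2 = v2 * (\<beta> * \<beta> - 2 * \<beta> * \<eta> + \<eta> * \<eta>)"
      by (simp add: power2_eq_square algebra_simps)
    also have "\<dots> = v2 + \<beta> * (\<beta> * v2 - 2 * \<eta> * v2)" unfolding e by (simp add: algebra_simps)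
    also have "\<dots> = 0" using v2 v3 2 by simp
    finally have "v2 = 0" using 2 by simp
    then show ?thesis using v1 v3 lam 2 by (simp add: mult.commute)
  qed
next
  have e: "\<eta> = 1 \<or> \<eta> = -1" using assms by auto
  assume ?R
  then show ?L
  proof
    assume "\<beta> \<noteq> \<eta> \<and> \<alpha> = 0 \<and> v1 = 2 - 2 * \<eta> * \<beta> \<and> v2 = 0 \<and> v3 = 0 \<and> lam = 0"
    then show ?L using e by auto
  next
    assume h: "\<alpha> - \<beta> + \<eta> = 0 \<and> v2 = - \<eta> * v3 \<and> v1 = 1 - \<eta> * \<beta> \<and> lam = \<alpha>\<^sup>2 / 4"
    then have "\<beta> = \<alpha> + \<eta>" by simp
    then show ?L using e h by (auto simp: algebra_simps power2_eq_square)
  qed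
qed

theorem theorem2p4:
  fixes G :: "'g::{t2_space, second_countable_topology} monoid"
    and A :: "('g, real^3) chart set"
    and g :: "'g metric"
    and D :: "'g vfield \<Rightarrow> 'g vfield \<Rightarrow> 'g vfield"
    and e1 e2 e3 :: "'g vfield"
    and \<alpha> \<beta> \<eta> v1 v2 v3 lam :: real
  assumes eta: "\<eta> \<in> {1, -1}"
    and lie_group: "lie_group G A"
    and connected: "connected (UNIV :: 'g set)"
    and simply_connected: "simply_connected (UNIV :: 'g set)"
    and lorentzian: "lorentzian_metric A g"
    and left_invariant: "left_invariant_metric G A g"
    and levi_civita: "levi_civita_connection A g D"
    and basis: "lie_algebra_basis3 G A e1 e2 e3"
    and orthonormal: "pseudo_orthonormal3 g e1 e2 e3"
    and bracket12: "lie_bracket e1 e2 = lincomb3 0 (-1) (2 * \<eta> - \<beta>) e1 e2 e3"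
    and bracket13: "lie_bracket e1 e3 = lincomb3 0 (-\<beta>) 1 e1 e2 e3"
    and bracket23: "lie_bracket e2 e3 = lincomb3 \<alpha> 0 0 e1 e2 e3"
  shows "left_invariant_riemann_soliton G A g D (lincomb3 v1 v2 v3 e1 e2 e3) lam \<longleftrightarrow>
      (\<beta> \<noteq> \<eta> \<and> \<alpha> = 0 \<and> v1 = 2 - 2 * \<eta> * \<beta> \<and> v2 = 0 \<and> v3 = 0 \<and> lam = 0)
    \<or> (\<alpha> - \<beta> + \<eta> = 0 \<and> v2 = - \<eta> * v3 \<and> v1 = 1 - \<eta> * \<beta> \<and> lam = \<alpha>\<^sup>2 / 4)"
proof -
  have atlas: "smooth_atlas A" using lie_group by (simp add: lie_group_def)
  have inv: "e1 \<in> left_invariant_fields G A" "e2 \<in> left_invariant_fields G A"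
    "e3 \<in> left_invariant_fields G A"
    using basis by (simp_all add: lie_algebra_basis3_def)
  interpret G4_frame A g D e1 e2 e3 \<alpha> \<beta> \<eta>
    by unfold_locales
      (use assms atlas inv in \<open>simp_all add: left_invariant_fields_def\<close>)
  let ?V = "lincomb3 v1 v2 v3 e1 e2 e3"
  \<comment> \<open>Left-invariance of \<open>?V\<close> holds for all coefficients, so only the
    tensor equation remains.\<close>
  have "left_invariant_riemann_soliton G A g D ?V lam \<longleftrightarrow>
      (\<forall>X\<in>VF. \<forall>Y\<in>VF. \<forall>Z\<in>VF. \<forall>W\<in>VF. \<forall>p. soliton_defect ?V lam X Y Z W p = 0)"
    using left_invariant_fields_lincomb3[OF atlas inv]
    by (simp add: left_invariant_riemann_soliton_def soliton_defect_def)
  also have "\<dots> \<longleftrightarrow> (2 + lam - \<alpha>\<^sup>2 / 4 + \<alpha> * \<eta> - 2 * \<beta> * \<eta> - v1 = 0 \<and>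
      \<alpha> - 2 * \<beta> + 2 * \<eta> - \<eta> * v1 = 0 \<and> \<beta> * v2 - \<alpha> * v2 - 2 * \<eta> * v2 - v3 = 0 \<and>
      2 - lam + \<alpha>\<^sup>2 / 4 + \<alpha> * \<eta> - 2 * \<beta> * \<eta> - v1 = 0 \<and> \<alpha> * v3 - \<beta> * v3 - v2 = 0 \<and>
      \<alpha> * \<beta> - \<alpha> * \<eta> - lam - 3 / 4 * \<alpha>\<^sup>2 = 0)"
    \<comment> \<open>The table repeats its six entries up to sign; the closing \<open>auto\<close>
      clears the factor 1/2 in \<open>K3\<close> and \<open>K5\<close>.\<close>
    by (simp only: soliton_defect_eq_0_iff[OF lincomb3_closed[OF frame_closed]] ball_simps
        soliton_defect_frame simp_thms neg_equal_0_iff_equal) auto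
  also note soliton_equations_iff[OF eta]
  finally show ?thesis .
qed

end
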